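(* If $G$ is a special Roman graph, then $\gamma_R(\mu(G))=\gamma_R(G)+1$.
   Context: All graphs are finite and simple. A Roman dominating function (RDF) of $G=(V,E)$ is a function $f:V\to\{0,1,2\}$ such that every vertex $v$ with $f(v)=0$ has a neighbor $w$ with $f(w)=2$; its weight is $\sum_{v}f(v)$, $\gamma_R(G)$ is the minimum weight of an RDF, and a $\gamma_R$-function is an RDF of weight $\gamma_R(G)$. Write $f=(V_0,V_1,V_2)$ with $V_i=\{v: f(v)=i\}$. $G$ is a special Roman graph if it has a $\gamma_R$-function $f=(V_0,V_1,V_2)$ with $V_1=\emptyset$ such that the induced subgraph $G[V_2]$ has no isolated vertex. The Mycielskian $\mu(G)$ of $G$ with $V(G)=\{v_1^0,\ldots,v_n^0\}$ has vertex set $\{v_j^0\}\cup\{v_j^1\}\cup\{u\}$ and edge set $E(G)\cup\{v_j^0v_{j'}^1 : v_j^0v_{j'}^0\in E(G)\}\cup\{v_j^1u: 1\leq j\leq n\}$. *)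

theory Defs
  imports "Graph_Theory.Graph_Theory"
begin

text \<open>
  Finite simple graphs are rendered by the locale \<^locale>\<open>pair_graph\<close>: an undirected edge
  between \<open>u\<close> and \<open>v\<close> is the pair of arcs \<open>(u, v)\<close>, \<open>(v, u)\<close>.  The null graph is allowed.
\<close>

definition roman_dominating :: "'a pair_pre_digraph \<Rightarrow> ('a \<Rightarrow> nat) \<Rightarrow> bool" where
  "roman_dominating G f \<longleftrightarrow>
     (\<forall>v \<in> pverts G. f v \<in> {0, 1, 2}) \<and>
     (\<forall>v \<in> pverts G. f v = 0 \<longrightarrow> (\<exists>w \<in> pverts G. v \<rightarrow>\<^bsub>G\<^esub> w \<and> f w = 2))"

definition roman_weight :: "'a pair_pre_digraph \<Rightarrow> ('a \<Rightarrow> nat) \<Rightarrow> nat" where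
  "roman_weight G f = (\<Sum>v \<in> pverts G. f v)"

text \<open>The minimum is over a nonempty set: the constant function \<open>1\<close> is Roman dominating.\<close>

definition roman_number :: "'a pair_pre_digraph \<Rightarrow> nat" where
  "roman_number G = (LEAST k. \<exists>f. roman_dominating G f \<and> roman_weight G f = k)"

definition roman_function :: "'a pair_pre_digraph \<Rightarrow> ('a \<Rightarrow> nat) \<Rightarrow> bool" where
  "roman_function G f \<longleftrightarrow> roman_dominating G f \<and> roman_weight G f = roman_number G"

definition roman_part :: "'a pair_pre_digraph \<Rightarrow> ('a \<Rightarrow> nat) \<Rightarrow> nat \<Rightarrow> 'a set" where
  "roman_part G f i = {v \<in> pverts G. f v = i}"

definition isolated_vertex :: "('a, 'b) pre_digraph \<Rightarrow> 'a \<Rightarrow> bool" where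
  "isolated_vertex H v \<longleftrightarrow> v \<in> verts H \<and> (\<forall>w \<in> verts H. \<not> v \<rightarrow>\<^bsub>H\<^esub> w)"

definition special_roman_graph :: "'a pair_pre_digraph \<Rightarrow> bool" where
  "special_roman_graph G \<longleftrightarrow> pair_graph G \<and>
     (\<exists>f. roman_function G f \<and> roman_part G f 1 = {} \<and>
          (\<nexists>v. isolated_vertex (G \<restriction> roman_part G f 2) v))"

datatype 'a mycielski_vertex = Orig 'a | Copy 'a | Apex

definition mycielskian :: "'a pair_pre_digraph \<Rightarrow> 'a mycielski_vertex pair_pre_digraph" where
  "mycielskian G = \<lparr>
     pverts = Orig ` pverts G \<union> Copy ` pverts G \<union> {Apex},
     parcs = {(Orig v, Orig w) | v w. (v, w) \<in> parcs G}
       \<union> {(Orig v, Copy w) | v w. (v, w) \<in> parcs G}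
       \<union> {(Copy w, Orig v) | v w. (v, w) \<in> parcs G}
       \<union> {(Copy v, Apex) | v. v \<in> pverts G}
       \<union> {(Apex, Copy v) | v. v \<in> pverts G} \<rparr>"

lemma pair_graph_mycielskian:
  assumes "pair_graph G"
  shows "pair_graph (mycielskian G)"
proof -
  interpret pair_graph G by fact
  let ?M = "mycielskian G"
  have arcs: "parcs ?M \<subseteq> pverts ?M \<times> pverts ?M"
    by (auto simp: mycielskian_def dest: in_arcsD1 in_arcsD2)
  have fin: "finite (pverts ?M)"
    by (simp add: mycielskian_def pair_finite_verts)
  have "finite (parcs ?M)"
    using arcs fin by (meson finite_SigmaI finite_subset)
  moreover have "sym (parcs ?M)"
    by (auto simp: mycielskian_def sym_def dest: arcs_symmetric)
  moreover have "fst e \<noteq> snd e" if "e \<in> parcs ?M" for e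
    using that by (auto simp: mycielskian_def dest: no_loops')
  ultimately show ?thesis
    using arcs fin by unfold_locales (auto simp: symmetric_def)
qed

end

theory Submission
  imports Defs
begin

text \<open>
  The lower bound holds for every graph.  Let \<open>g\<close> be Roman dominating on the Mycielskian.  If
  \<open>g Apex > 0\<close>, the maximum of \<open>g\<close> over the two versions of each vertex is Roman dominating on
  \<open>G\<close>, and \<open>g Apex\<close> is saved.  If \<open>g Apex = 0\<close>, some copy has value \<open>2\<close>, while a copy of value
  \<open>0\<close> can only be dominated by an original vertex of value \<open>2\<close>; hence all copies may be truncated
  to \<open>1\<close> before taking the maximum, which saves at least \<open>1\<close>.

  For the upper bound, extend a special \<open>f\<close> by \<open>0\<close> on the copies and \<open>1\<close> at the apex: the
  copy of a vertex of value \<open>2\<close> is dominated because that vertex has a neighbour of value \<open>2\<close>.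
\<close>

lemma roman_number_le:
  assumes "roman_dominating G f"
  shows "roman_number G \<le> roman_weight G f"
  unfolding roman_number_def using assms by (intro Least_le) blast

lemma roman_function_exists: "\<exists>f. roman_function G f"
proof -
  have "roman_dominating G (\<lambda>_. 1)"
    by (simp add: roman_dominating_def)
  then have "\<exists>k f. roman_dominating G f \<and> roman_weight G f = k"
    by blast
  from LeastI_ex[OF this] show ?thesis
    by (auto simp: roman_function_def roman_number_def)
qed

lemma roman_weight_mycielskian:
  assumes "finite (pverts G)"
  shows "roman_weight (mycielskian G) g =
    (\<Sum>v \<in> pverts G. g (Orig v) + g (Copy v)) + g Apex"
proof -
  let ?O = "Orig ` pverts G" and ?C = "Copy ` pverts G"
  have "roman_weight (mycielskian G) g = sum g (?O \<union> ?C) + g Apex"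
    unfolding roman_weight_def mycielskian_def using assms
    by (simp add: sum.union_disjoint image_iff add.commute)
  also have "sum g (?O \<union> ?C) = sum g ?O + sum g ?C"
    using assms by (intro sum.union_disjoint) auto
  also have "\<dots> = (\<Sum>v \<in> pverts G. g (Orig v) + g (Copy v))"
    by (simp add: sum.reindex inj_on_def sum.distrib)
  finally show ?thesis .
qed

lemma roman_number_mycielskian_ge:
  assumes "pair_graph G"
  shows "roman_number G + 1 \<le> roman_number (mycielskian G)"
proof -
  interpret pair_graph G by fact
  let ?M = "mycielskian G"
  obtain g where g: "roman_dominating ?M g" "roman_weight ?M g = roman_number ?M"
    using roman_function_exists by (auto simp: roman_function_def)
  have vals: "g x \<in> {0, 1, 2}" if "x \<in> pverts ?M" for x
    using g(1) that by (auto simp: roman_dominating_def)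
  have vO: "g (Orig v) \<in> {0, 1, 2}" and vC: "g (Copy v) \<in> {0, 1, 2}" if "v \<in> pverts G" for v
    by (rule vals, use that in \<open>simp add: mycielskian_def\<close>)+
  have dom: "\<exists>y \<in> pverts ?M. (x, y) \<in> parcs ?M \<and> g y = 2" if "x \<in> pverts ?M" "g x = 0" for x
    using g(1) that by (auto simp: roman_dominating_def)
  have "\<exists>h. roman_dominating G h \<and> roman_weight G h + 1 \<le> roman_weight ?M g"
  proof (cases "g Apex = 0")
    case False
    let ?h = "\<lambda>v. max (g (Orig v)) (g (Copy v))"
    have "\<exists>w \<in> pverts G. (v, w) \<in> parcs G \<and> ?h w = 2" if v: "v \<in> pverts G" "?h v = 0" for v
    proof -
      have "\<exists>y \<in> pverts ?M. (Orig v, y) \<in> parcs ?M \<and> g y = 2"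
        by (rule dom) (use v in \<open>auto simp: mycielskian_def\<close>)
      \<comment> \<open>The apex is not adjacent to originals, so the dominating vertex is a version
        of a neighbour of \<open>v\<close> in \<open>G\<close>.\<close>
      then obtain w where "w \<in> pverts G" "(v, w) \<in> parcs G" "g (Orig w) = 2 \<or> g (Copy w) = 2"
        by (auto simp: mycielskian_def)
      with vO[of w] vC[of w] show ?thesis by force
    qed
    moreover have "?h v \<in> {0, 1, 2}" if "v \<in> pverts G" for v
      using vO[OF that] vC[OF that] by auto
    ultimately have "roman_dominating G ?h"
      unfolding roman_dominating_def with_proj_simps by blast
    moreover have "roman_weight G ?h \<le> (\<Sum>v \<in> pverts G. g (Orig v) + g (Copy v))"
      unfolding roman_weight_def by (intro sum_mono) simp
    ultimately show ?thesis
      using False roman_weight_mycielskian[OF pair_finite_verts, of g] by (intro exI[of _ ?h]) simp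
  next
    case True
    let ?h = "\<lambda>v. max (g (Orig v)) (min 1 (g (Copy v)))"
    have "\<exists>w \<in> pverts G. (v, w) \<in> parcs G \<and> ?h w = 2" if v: "v \<in> pverts G" "?h v = 0" for v
    proof -
      \<comment> \<open>Domination is used at \<open>Copy v\<close>, not at \<open>Orig v\<close>:
        the latter might be dominated only by a copy, whose value 2 is lost in
        \<open>?h\<close>.\<close>
      have "\<exists>y \<in> pverts ?M. (Copy v, y) \<in> parcs ?M \<and> g y = 2"
        by (rule dom) (use v in \<open>auto simp: mycielskian_def min_def split: if_splits\<close>)
      then obtain w where "w \<in> pverts G" "(v, w) \<in> parcs G" "g (Orig w) = 2"
        using True by (auto simp: mycielskian_def intro: arcs_symmetric)
      then show ?thesis by force
    qed
    moreover have "?h v \<in> {0, 1, 2}" if "v \<in> pverts G" for v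
      using vO[OF that] vC[OF that] by auto
    ultimately have dom_h: "roman_dominating G ?h"
      unfolding roman_dominating_def with_proj_simps by blast
    have "\<exists>y \<in> pverts ?M. (Apex, y) \<in> parcs ?M \<and> g y = 2"
      by (rule dom) (use True in \<open>auto simp: mycielskian_def\<close>)
    then obtain w where w: "w \<in> pverts G" "g (Copy w) = 2"
      by (auto simp: mycielskian_def)
    \<comment> \<open>Strictness comes from \<open>w\<close>, where the truncated copy gives max a 1
      < a + 2 with a = \<open>g (Orig w)\<close>.\<close>
    have "roman_weight G ?h < (\<Sum>v \<in> pverts G. g (Orig v) + g (Copy v))"
      unfolding roman_weight_def
      by (rule sum_strict_mono_ex1) (use w in \<open>auto intro!: bexI[of _ w]\<close>)
    then show ?thesis
      using dom_h True roman_weight_mycielskian[OF pair_finite_verts, of g]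
      by (intro exI[of _ ?h]) simp
  qed
  then show ?thesis
    using roman_number_le g(2) by (metis add_le_mono1 le_trans)
qed

theorem theorem2:
  fixes G :: "'a pair_pre_digraph"
  assumes "special_roman_graph G"
  shows "roman_number (mycielskian G) = roman_number G + 1"
proof (rule antisym)
  interpret pair_graph G
    using assms by (simp add: special_roman_graph_def)
  obtain f where f: "roman_dominating G f" "roman_weight G f = roman_number G"
    and no1: "roman_part G f 1 = {}"
    and no_iso: "\<nexists>v. isolated_vertex (G \<restriction> roman_part G f 2) v"
    using assms by (auto simp: special_roman_graph_def roman_function_def)
  \<comment> \<open>The vertices of value 2 form a total dominating set: they dominate each other as
    well as the vertices of value 0, and no vertex has value 1.\<close>
  have nbr: "\<exists>w \<in> pverts G. (v, w) \<in> parcs G \<and> f w = 2" if v: "v \<in> pverts G" for v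
  proof (cases "f v = 0")
    case True
    with f(1) v show ?thesis by (auto simp: roman_dominating_def)
  next
    case False
    with f(1) no1 v have "v \<in> roman_part G f 2"
      by (auto simp: roman_dominating_def roman_part_def)
    with no_iso obtain w where "w \<in> roman_part G f 2" "v \<rightarrow>\<^bsub>G \<restriction> roman_part G f 2\<^esub> w"
      by (auto simp: isolated_vertex_def)
    then show ?thesis
      by (auto simp: roman_part_def arcs_ends_def arc_to_ends_def)
  qed
  let ?g = "case_mycielski_vertex f (\<lambda>_. 0) (1 :: nat)"
  have "\<exists>y \<in> pverts (mycielskian G). (x, y) \<in> parcs (mycielskian G) \<and> ?g y = 2"
    if x: "x \<in> pverts (mycielskian G)" "?g x = 0" for x
  proof -
    \<comment> \<open>The apex is excluded by its value 1, the only weight added to that of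
      \<open>f\<close>.\<close>
    obtain v where v: "v \<in> pverts G" "x = Orig v \<or> x = Copy v"
      using x by (auto simp: mycielskian_def)
    obtain w where w: "w \<in> pverts G" "(v, w) \<in> parcs G" "f w = 2"
      using nbr[OF v(1)] by blast
    show ?thesis
      \<comment> \<open>\<open>Orig w\<close> serves both versions of \<open>v\<close>; the arc from
        \<open>Copy v\<close> to \<open>Orig w\<close> stems from the reversed arc
        \<open>(w, v)\<close>.\<close>
      using v w arcs_symmetric[OF w(2)]
      by (intro bexI[of _ "Orig w"]) (auto simp: mycielskian_def)
  qed
  moreover have "?g x \<in> {0, 1, 2}" if "x \<in> pverts (mycielskian G)" for x
    using that f(1) by (auto simp: mycielskian_def roman_dominating_def)
  ultimately have "roman_dominating (mycielskian G) ?g"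
    unfolding roman_dominating_def with_proj_simps by blast
  then have "roman_number (mycielskian G) \<le> roman_weight (mycielskian G) ?g"
    by (rule roman_number_le)
  also have "\<dots> = roman_number G + 1"
    using roman_weight_mycielskian[OF pair_finite_verts, of ?g] f(2)
    by (simp add: roman_weight_def)
  finally show "roman_number (mycielskian G) \<le> roman_number G + 1" .
  show "roman_number G + 1 \<le> roman_number (mycielskian G)"
    by (rule roman_number_mycielskian_ge) unfold_locales
qed

end
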